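(* Let $p$ be an odd prime, $k\ge2$, $1\le s\le3$, $r=k+s$, and $0\le l<p^k$. The $p^{(k)}$-Fibonacci numbers $\mathcal M_{s,k}(l)=\mathcal M\big(\lambda(2r;(x_{(2s,k)},x_{(s,k)}+l))\big)$ are as follows. For $s=1$: $\mathcal M_{1,k}(l)=\frac{p-1}{2}$ for all $0\le l\le p^k-1$. For $s=2$: $\mathcal M_{2,k}(l)=\frac{p-1}{2}(2p+1)$ if $0\le l<\frac{p^k-1}{2}$, and $\mathcal M_{2,k}(l)=\frac{p-1}{2}(2p-1)$ if $\frac{p^k-1}{2}\le l<p^k$. For $s=3$: $$\mathcal M_{3,k}(l)=\begin{cases} \frac{p-1}{2}(4p^2+1), & l=0;\\[2pt] \frac{p-1}{2}(4p^2+2t+1), & (t-1)\sum_{\iota=0}^{k-1}p^\iota+1\le l\le t\sum_{\iota=0}^{k-1}p^\iota,\ 1\le t\le\frac{p-3}{2};\\[2pt] \frac{p-1}{2}(4p^2+1+p-1), & \frac{p-3}{2}\sum_{\iota=0}^{k-1}p^\iota+1\le l\le\frac{p-1}{2}\sum_{\iota=1}^{k-1}p^\iota-1;\\[2pt] \frac{p-1}{2}(4p^2-1+p-1), & \frac{p-1}{2}\sum_{\iota=1}^{k-1}p^\iota\le l\le\frac{p-1}{2}\sum_{\iota=0}^{k-1}p^\iota-1;\\[2pt] \frac{p-1}{2}(4p^2-1-p-1), & l=\frac{p-1}{2}\sum_{\iota=0}^{k-1}p^\iota;\\[2pt] \frac{p-1}{2}(4p^2-1+2(t-p)), & (t-1)\sum_{\iota=0}^{k-1}p^\iota+1\le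 l\le t\sum_{\iota=0}^{k-1}p^\iota,\ \frac{p+1}{2}\le t\le p-1. \end{cases}$$
   Context: Notation: $p$ is an odd prime, $k\ge0$, $r\ge1$ integers with $s=r-k\ge1$, $0\le l<p^k$; $x_{(a,k)}=p^k(ap-(a+1))$ for $a\ge1$. $\lambda(c;(n,i))$ denotes the hook partition $(n-i,1^i)$ of $n$, regarded as a vertex on floor $c$ of the $p$-Bratteli diagram. Paths. $P^{2r}_l$ is the set of all downward paths in the diagram from $\lambda(2r;(x_{(2s,k)},x_{(s,k)}+l))$ to floor $1$. Along a path, blocks $B(i;(m_i,n_i))$ ($m_i$ horizontal nodes and $n_i$ vertical nodes) are removed for $i=2r-1,2r-2,\dots,1$. Explicitly, a path $P$ is determined by arbitrary integers $u_s,u_{s-1},\dots,u_2\in\{0,\dots,p-1\}$ and $u_1\in\{0,\dots,p-2\}$ (distinct choices give distinct paths, and all paths arise). Put $L_s=l$ and, for $j=s,s-1,\dots,2$, $L'_j=L_j+p^ku_j$ and $L_{j-1}=\lfloor L'_j/p\rfloor$. The path visits $\lambda(2(k+j);(x_{(2j,k)},x_{(j,k)}+L_j))$ for $1\le j\le s$, $\lambda(2(k+j)-1;(x_{(2j-1,k)},x_{(j-1,k)}+L'_j))$ for $2\le j\le s$, and $\lambda(2k+1;(p^k(p-1),L_1+p^ku_1))$; below floor $2k+1$ the path is forced. The blocks are, for $2\le j\le s$, $$m_{2(k+j)-1}=p^ku_j,\quad n_{2(k+j)-1}=p^k(p-1-u_j),\quad n_{2(k+j)-2}=L'_j-\lfloor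 L'_j/p\rfloor,\quad m_{2(k+j)-2}=p^k(p-1)-n_{2(k+j)-2},$$ and $m_{2k+1}=p^ku_1$, $n_{2k+1}=p^k(p-2-u_1)$. Descents. For $2k+2\le i\le 2r-2$, $P$ has a descent at block $i$ if $m_i>m_{i+1}$ and $n_i<n_{i+1}$ (these blocks all have size $m_i+n_i=p^k(p-1)$). By convention $P$ has a descent at block $2k$ if and only if $u_1<\frac{p-1}{2}$, it has no descent at block $2k+1$, and none at blocks below $2k$. $\mathrm{des}(P)$ is the number of descents of $P$. The $p^{(k)}$-Fibonacci number of the vertex is $$\mathcal M_{s,k}(l):=\mathcal M\big(\lambda(2r;(x_{(2s,k)},x_{(s,k)}+l))\big)=\sum_{P\in P^{2r}_l}\mathrm{des}(P).$$ *)

theory Defs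
  imports "HOL-Computational_Algebra.Primes" "HOL-Library.FuncSet"
begin

definition x_num :: "nat \<Rightarrow> nat \<Rightarrow> nat \<Rightarrow> nat" where
  "x_num p a k = p ^ k * (a * p - (a + 1))"

text \<open>Partitions are weakly decreasing lists of parts; this is the hook \<open>(n - i, 1\<^sup>i)\<close> of \<open>n\<close>.\<close>

definition hook :: "nat \<Rightarrow> nat \<Rightarrow> nat list" where
  "hook n i = (n - i) # replicate i 1"

text \<open>
  Free choices \<open>u\<^sub>1, \<dots>, u\<^sub>s\<close> along a path, and the numbers determined by them:
  \<open>L\<^sub>s = l\<close>, \<open>L'\<^sub>j = L\<^sub>j + p\<^sup>k u\<^sub>j\<close>, \<open>L\<^sub>j\<^sub>-\<^sub>1 = \<lfloor>L'\<^sub>j / p\<rfloor>\<close>.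
  The recursion runs on the distance \<open>d = s - j\<close> from the top.
\<close>

definition choices :: "nat \<Rightarrow> nat \<Rightarrow> (nat \<Rightarrow> nat) set" where
  "choices p s = (\<Pi>\<^sub>E j\<in>{1..s}. if j = 1 then {0..p - 2} else {0..p - 1})"

primrec L_down :: "nat \<Rightarrow> nat \<Rightarrow> nat \<Rightarrow> nat \<Rightarrow> (nat \<Rightarrow> nat) \<Rightarrow> nat \<Rightarrow> nat" where
  "L_down p k s l u 0 = l"
| "L_down p k s l u (Suc d) = (L_down p k s l u d + p ^ k * u (s - d)) div p"

definition L_num :: "nat \<Rightarrow> nat \<Rightarrow> nat \<Rightarrow> nat \<Rightarrow> (nat \<Rightarrow> nat) \<Rightarrow> nat \<Rightarrow> nat" where
  "L_num p k s l u j = L_down p k s l u (s - j)"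

definition L'_num :: "nat \<Rightarrow> nat \<Rightarrow> nat \<Rightarrow> nat \<Rightarrow> (nat \<Rightarrow> nat) \<Rightarrow> nat \<Rightarrow> nat" where
  "L'_num p k s l u j = L_num p k s l u j + p ^ k * u j"

text \<open>
  A downward path starting on floor \<open>2r = 2(k + s)\<close> is the function assigning to each floor
  the partition visited there. Only the floors down to \<open>2k + 1\<close> are recorded: below them the path is
  forced and carries no descents beyond the one prescribed by convention at block \<open>2k\<close>.
\<close>

definition path_of :: "nat \<Rightarrow> nat \<Rightarrow> nat \<Rightarrow> nat \<Rightarrow> (nat \<Rightarrow> nat) \<Rightarrow> nat \<Rightarrow> nat list" where
  "path_of p k s l u =
     (\<lambda>c\<in>{2 * k + 1..2 * (k + s)}.
        if c = 2 * k + 1 then hook (p ^ k * (p - 1)) (L_num p k s l u 1 + p ^ k * u 1)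
        else if even c then
          (let j = c div 2 - k
           in hook (x_num p (2 * j) k) (x_num p j k + L_num p k s l u j))
        else
          (let j = (c + 1) div 2 - k
           in hook (x_num p (2 * j - 1) k) (x_num p (j - 1) k + L'_num p k s l u j)))"

definition paths :: "nat \<Rightarrow> nat \<Rightarrow> nat \<Rightarrow> nat \<Rightarrow> (nat \<Rightarrow> nat list) set" where
  "paths p k s l = path_of p k s l ` choices p s"

text \<open>
  Block \<open>i\<close> is what is removed in passing from floor \<open>i + 1\<close> to floor \<open>i\<close>: \<open>m\<^sub>i\<close> nodes of the first
  row and \<open>n\<^sub>i\<close> nodes of the first column. The closed formulas for these numbers are
  \<open>odd_block\<close>, \<open>even_block\<close> and \<open>bottom_block\<close> below.
\<close>

definition m_block :: "(nat \<Rightarrow> nat list) \<Rightarrow> nat \<Rightarrow> nat" where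
  "m_block P i = hd (P (Suc i)) - hd (P i)"

definition n_block :: "(nat \<Rightarrow> nat list) \<Rightarrow> nat \<Rightarrow> nat" where
  "n_block P i = length (P (Suc i)) - length (P i)"

text \<open>
  Since \<open>m\<^sub>2\<^sub>k\<^sub>+\<^sub>1 = p\<^sup>k u\<^sub>1\<close>, this recovers \<open>u\<^sub>1\<close> from the path; see \<open>u1_path_of\<close>.
\<close>

definition u1_of :: "nat \<Rightarrow> nat \<Rightarrow> (nat \<Rightarrow> nat list) \<Rightarrow> nat" where
  "u1_of p k P = m_block P (2 * k + 1) div p ^ k"

definition is_descent :: "nat \<Rightarrow> nat \<Rightarrow> nat \<Rightarrow> (nat \<Rightarrow> nat list) \<Rightarrow> nat \<Rightarrow> bool" where
  "is_descent p k s P i \<longleftrightarrow>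
     (i = 2 * k \<and> u1_of p k P < (p - 1) div 2) \<or>
     (2 * k + 2 \<le> i \<and> i \<le> 2 * (k + s) - 2 \<and>
      m_block P i > m_block P (i + 1) \<and> n_block P i < n_block P (i + 1))"

definition des :: "nat \<Rightarrow> nat \<Rightarrow> nat \<Rightarrow> (nat \<Rightarrow> nat list) \<Rightarrow> nat" where
  "des p k s P = card {i. is_descent p k s P i}"

definition fib_num :: "nat \<Rightarrow> nat \<Rightarrow> nat \<Rightarrow> nat \<Rightarrow> nat" where
  "fib_num p k s l = (\<Sum>P\<in>paths p k s l. des p k s P)"


lemma hd_hook [simp]: "hd (hook n i) = n - i"
  by (simp add: hook_def)

lemma length_hook [simp]: "length (hook n i) = Suc i"
  by (simp add: hook_def)

lemma choices_1: "u \<in> choices p s \<Longrightarrow> 1 \<le> s \<Longrightarrow> u 1 \<le> p - 2"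
  by (fastforce simp: choices_def dest: PiE_mem)

lemma choices_le: "u \<in> choices p s \<Longrightarrow> 1 \<le> j \<Longrightarrow> j \<le> s \<Longrightarrow> u j \<le> p - 1"
  by (cases "j = 1") (fastforce simp: choices_def dest: PiE_mem)+

lemma L_num_rec:
  assumes "2 \<le> j" "j \<le> s"
  shows "L_num p k s l u (j - 1) = L'_num p k s l u j div p"
proof -
  have "s - (j - 1) = Suc (s - j)" "s - (s - j) = j"
    using assms by auto
  then show ?thesis
    by (simp add: L_num_def L'_num_def)
qed

lemma add_mult_less_power_Suc:
  fixes p k a b :: nat
  assumes "a < p ^ k" "b \<le> p - 1" "0 < p"
  shows "a + p ^ k * b < p ^ k * p"
proof -
  have "p ^ k * Suc b \<le> p ^ k * p"
    using assms by (intro mult_le_mono2) auto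
  then show ?thesis
    using assms(1) by simp
qed

lemma L_down_less:
  assumes "0 < p" "l < p ^ k" "u \<in> choices p s" "d < s"
  shows "L_down p k s l u d < p ^ k"
  using assms(4)
proof (induction d)
  case (Suc d)
  have "L_down p k s l u d + p ^ k * u (s - d) < p ^ k * p"
    using Suc assms by (intro add_mult_less_power_Suc choices_le) auto
  then show ?case
    using \<open>0 < p\<close> by (simp add: less_mult_imp_div_less)
qed (use assms in simp)

lemma L_num_less:
  assumes "0 < p" "l < p ^ k" "u \<in> choices p s" "1 \<le> j" "j \<le> s"
  shows "L_num p k s l u j < p ^ k"
  unfolding L_num_def using assms by (intro L_down_less) auto

lemma L'_num_less:
  assumes "0 < p" "l < p ^ k" "u \<in> choices p s" "1 \<le> j" "j \<le> s"
  shows "L'_num p k s l u j < p ^ k * p"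
  unfolding L'_num_def
  using assms by (intro add_mult_less_power_Suc L_num_less choices_le) auto

lemma path_of_even:
  assumes "1 \<le> j" "j \<le> s"
  shows "path_of p k s l u (2 * (k + j)) = hook (x_num p (2 * j) k) (x_num p j k + L_num p k s l u j)"
proof -
  have "2 * (k + j) \<noteq> 2 * k + 1"
    by presburger
  then show ?thesis
    using assms by (simp add: path_of_def)
qed

lemma path_of_odd:
  assumes "2 \<le> j" "j \<le> s"
  shows "path_of p k s l u (2 * (k + j) - 1) =
    hook (x_num p (2 * j - 1) k) (x_num p (j - 1) k + L'_num p k s l u j)"
proof -
  obtain i where i: "j = Suc (Suc i)"
    using assms by (metis One_nat_def Suc_1 Suc_le_D Suc_le_mono)
  then show ?thesis
    using assms by (simp add: path_of_def)
qed

lemma path_of_bottom: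
  assumes "1 \<le> s"
  shows "path_of p k s l u (2 * k + 1) = hook (p ^ k * (p - 1)) (L_num p k s l u 1 + p ^ k * u 1)"
  using assms by (simp add: path_of_def)

lemma x_num_Suc:
  assumes "3 \<le> p" "1 \<le> a"
  shows "x_num p (Suc a) k = x_num p a k + p ^ k * (p - 1)"
proof -
  have "a * 3 \<le> a * p"
    using assms by (intro mult_le_mono2)
  then have "Suc a * p - (Suc a + 1) = (a * p - (a + 1)) + (p - 1)"
    using assms unfolding mult_Suc by linarith
  then show ?thesis
    unfolding x_num_def by (simp only: add_mult_distrib2)
qed

lemma x_num_one: "x_num p 1 k = p ^ k * (p - 2)"
  by (simp add: x_num_def numeral_2_eq_2)

lemma x_num_diff:
  assumes "3 \<le> p" "1 \<le> a"
  shows "x_num p (a + d) k = x_num p a k + d * (p ^ k * (p - 1))"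
proof (induction d)
  case (Suc d)
  then show ?case
    using x_num_Suc[OF assms(1), of "a + d" k] assms(2) by simp
qed simp

lemma odd_block:
  assumes "3 \<le> p" "l < p ^ k" "u \<in> choices p s" "2 \<le> j" "j \<le> s"
  defines "P \<equiv> path_of p k s l u"
  shows "m_block P (2 * (k + j) - 1) = p ^ k * u j"
    and "n_block P (2 * (k + j) - 1) = p ^ k * (p - 1 - u j)"
proof -
  obtain i where i: "j = Suc i" "1 \<le> i"
    using assms by (cases j) auto
  define A where "A = p ^ k * (p - 1)"
  define U where "U = p ^ k * u j"
  have U: "U \<le> A" "p ^ k * (p - 1 - u j) = A - U"
    using mult_le_mono2[OF choices_le[OF assms(3), of j], of "p ^ k"] assms(4,5)
    by (simp_all only: U_def A_def diff_mult_distrib2 mult_1_right)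
  have L': "L'_num p k s l u j = L_num p k s l u j + U"
    by (simp add: L'_num_def U_def)
  have x: "x_num p (2 * j) k = x_num p i k + (j + 1) * A"
          "x_num p (2 * j - 1) k = x_num p i k + j * A"
          "x_num p j k = x_num p i k + A"
    using x_num_diff[OF assms(1) i(2), of "j + 1" k] x_num_diff[OF assms(1) i(2), of j k]
      x_num_diff[OF assms(1) i(2), of 1 k] i(1)
    by (auto simp: A_def mult_2)
  have jA: "L_num p k s l u j + U < j * A"
  proof -
    have "p \<le> j * (p - 1)"
      using mult_le_mono1[OF \<open>2 \<le> j\<close>, of "p - 1"] assms(1) by linarith
    then have "p ^ k * p \<le> j * A"
      unfolding A_def by (metis mult.left_commute mult_le_mono2)
    then show ?thesis
      using L'_num_less[OF _ assms(2,3), of j] assms(1,4,5) L' by simp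
  qed
  have S: "Suc (2 * (k + j) - 1) = 2 * (k + j)"
    using assms(4) by simp
  have P: "P (2 * (k + j)) = hook (x_num p (2 * j) k) (x_num p j k + L_num p k s l u j)"
    "P (2 * (k + j) - 1) = hook (x_num p (2 * j - 1) k) (x_num p i k + L'_num p k s l u j)"
    using path_of_even[of j s p k l u] path_of_odd[of j s p k l u] assms(4,5) i
    by (simp_all add: P_def)
  show "m_block P (2 * (k + j) - 1) = p ^ k * u j"
    unfolding m_block_def S P hd_hook x L' U_def[symmetric] using jA U(1) by simp
  show "n_block P (2 * (k + j) - 1) = p ^ k * (p - 1 - u j)"
    unfolding n_block_def S P length_hook x L' U(2) by simp
qed

lemma even_block:
  assumes "3 \<le> p" "l < p ^ k" "u \<in> choices p s" "2 \<le> j" "j \<le> s"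
  defines "P \<equiv> path_of p k s l u"
    and "N \<equiv> L'_num p k s l u j - L'_num p k s l u j div p"
  shows "n_block P (2 * (k + j) - 2) = N"
    and "m_block P (2 * (k + j) - 2) = p ^ k * (p - 1) - N"
    and "N \<le> p ^ k * (p - 1)"
proof -
  obtain i where i: "j = Suc i" "1 \<le> i"
    using assms by (cases j) auto
  define A where "A = p ^ k * (p - 1)"
  define L' where "L' = L'_num p k s l u j"
  have L: "L_num p k s l u i = L' div p"
    using L_num_rec[of j s p k l u] assms(4,5) i by (simp add: L'_def)
  have L'_less: "L' < p ^ k * p"
    unfolding L'_def using assms by (intro L'_num_less) auto
  have div_le: "L' div p \<le> L'"
    by simp
  have pA: "p ^ k * p = p ^ k + A"
    using assms(1) by (cases p) (auto simp: A_def)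
  show N: "N \<le> p ^ k * (p - 1)"
  proof -
    define q where "q = L' div p"
    have eq: "L' = p * q + L' mod p" "L' mod p < p"
      using assms(1) by (simp_all add: q_def)
    have "q < p ^ k"
      using L'_less by (simp add: q_def less_mult_imp_div_less)
    then have "(p - 1) * Suc q \<le> (p - 1) * p ^ k"
      by (intro mult_le_mono2) simp
    moreover have "L' - q \<le> (p - 1) * Suc q"
    proof -
      have "p * q = (p - 1) * q + q"
        using assms(1) by (cases p) auto
      then show ?thesis
        using eq by simp
    qed
    ultimately show ?thesis
      by (simp add: N_def L'_def[symmetric] q_def mult.commute)
  qed
  have x: "x_num p (2 * j - 1) k = x_num p i k + j * A"
          "x_num p (2 * i) k = x_num p i k + i * A"
    using x_num_diff[OF assms(1) i(2), of j k] x_num_diff[OF assms(1) i(2), of i k] i(1)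
    by (auto simp: A_def mult_2)
  have jA: "j * A = i * A + A"
    using i by simp
  have iA: "L' div p < i * A"
  proof -
    have "L' div p < p ^ k"
      using L'_less by (simp add: less_mult_imp_div_less)
    also have "\<dots> \<le> i * A"
    proof -
      have "p ^ k * 1 \<le> A"
        unfolding A_def using assms(1) by (intro mult_le_mono2) simp
      also have "\<dots> \<le> i * A"
        using i(2) by simp
      finally show ?thesis by simp
    qed
    finally show ?thesis .
  qed
  have S: "Suc (2 * (k + j) - 2) = 2 * (k + j) - 1" "2 * (k + j) - 2 = 2 * (k + i)"
    using i by simp_all
  have P: "P (2 * (k + i)) = hook (x_num p (2 * i) k) (x_num p i k + L' div p)"
    "P (2 * (k + j) - 1) = hook (x_num p (2 * j - 1) k) (x_num p i k + L')"
    using path_of_even[of i s p k l u] path_of_odd[of j s p k l u] assms(4,5) i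
    by (simp_all add: P_def L L'_def)
  have N': "N = L' - L' div p"
    by (simp add: N_def L'_def)
  show "n_block P (2 * (k + j) - 2) = N"
    unfolding n_block_def S(1) unfolding S(2) P length_hook N' by simp
  show "m_block P (2 * (k + j) - 2) = p ^ k * (p - 1) - N"
    unfolding m_block_def S(1) unfolding S(2) P hd_hook x jA A_def[symmetric]
    using iA div_le N unfolding N' A_def[symmetric] by simp
qed

lemma bottom_block:
  assumes "3 \<le> p" "l < p ^ k" "u \<in> choices p s" "1 \<le> s"
  defines "P \<equiv> path_of p k s l u"
  shows "m_block P (2 * k + 1) = p ^ k * u 1"
    and "n_block P (2 * k + 1) = p ^ k * (p - 2 - u 1)"
proof -
  define B where "B = p ^ k * (p - 2)"
  define U where "U = p ^ k * u 1"
  have U: "U \<le> B" "p ^ k * (p - 2 - u 1) = B - U"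
    using mult_le_mono2[OF choices_1[OF assms(3,4)], of "p ^ k"]
    by (simp_all only: U_def B_def diff_mult_distrib2)
  have B: "p ^ k * (p - 1) = B + p ^ k"
  proof -
    have "p - 1 = (p - 2) + 1"
      using assms(1) by simp
    then show ?thesis
      unfolding B_def by (simp only: add_mult_distrib2)
  qed
  have x: "x_num p 1 k = B" "x_num p 2 k = B + (B + p ^ k)"
    using x_num_Suc[OF assms(1), of 1 k] x_num_one[of p k] B
    by (simp_all add: B_def numeral_2_eq_2)
  have L: "L_num p k s l u 1 < p ^ k"
    using assms by (intro L_num_less) auto
  have P: "P (Suc (2 * k + 1)) = hook (x_num p 2 k) (x_num p 1 k + L_num p k s l u 1)"
    "P (2 * k + 1) = hook (p ^ k * (p - 1)) (L_num p k s l u 1 + U)"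
    using path_of_even[of 1 s p k l u] path_of_bottom[of s p k l u] assms(4)
    by (simp_all add: P_def U_def)
  show "m_block P (2 * k + 1) = p ^ k * u 1"
    unfolding m_block_def P hd_hook x B U_def[symmetric] using U(1) L by simp
  show "n_block P (2 * k + 1) = p ^ k * (p - 2 - u 1)"
    unfolding n_block_def P length_hook x U(2) using U(1) by simp
qed

lemma u1_path_of:
  assumes "3 \<le> p" "l < p ^ k" "u \<in> choices p s" "1 \<le> s"
  shows "u1_of p k (path_of p k s l u) = u 1"
  using bottom_block(1)[OF assms] assms(1) by (simp add: u1_of_def)

lemma path_of_inj:
  assumes "3 \<le> p" "l < p ^ k"
  shows "inj_on (path_of p k s l) (choices p s)"
proof (rule inj_onI)
  fix u v
  assume u: "u \<in> choices p s" and v: "v \<in> choices p s"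
    and eq: "path_of p k s l u = path_of p k s l v"
  show "u = v"
  proof (rule PiE_ext)
    show "u \<in> (\<Pi>\<^sub>E j\<in>{1..s}. if j = 1 then {0..p - 2} else {0..p - 1})"
      "v \<in> (\<Pi>\<^sub>E j\<in>{1..s}. if j = 1 then {0..p - 2} else {0..p - 1})"
      using u v by (simp_all add: choices_def)
    fix j assume j: "j \<in> {1..s}"
    show "u j = v j"
    proof (cases "j = 1")
      case True
      then show ?thesis
        using u1_path_of[OF assms u] u1_path_of[OF assms v] eq j by simp
    next
      case False
      then have "p ^ k * u j = p ^ k * v j"
        using odd_block(1)[OF assms u, of j] odd_block(1)[OF assms v, of j] eq j by simp
      then show ?thesis
        using assms(1) by simp
    qed
  qed
qed

end

theory Submission
  imports Defs
begin

text \<open>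
  Write \<open>p = 2h + 1\<close> and \<open>p\<^sup>k = r p\<close>. Every descent of a path is a condition on one or two of the choices
  \<open>u\<^sub>j\<close>, so the sum of \<open>des\<close> over all paths can be taken condition by condition. For a fixed \<open>L < p\<^sup>k\<close>, the
  number of \<open>u\<close> giving a descent at an even block is \<open>h\<close>, plus one if \<open>L - \<lfloor>L/p\<rfloor> < h r\<close>; the number of pairs
  giving a descent at an odd block is \<open>h p\<close> plus the number of \<open>e < p\<close> with \<open>e r < L - \<lfloor>L/p\<rfloor>\<close>. Since
  \<open>L - \<lfloor>L/p\<rfloor>\<close> is monotone in \<open>L\<close> and equals \<open>e r\<close> at \<open>L = e (1 + p + \<dots> + p\<^sup>k\<^sup>-\<^sup>1)\<close>, these multiples are the
  thresholds in \<open>l\<close>.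
\<close>

text \<open>
  With \<open>q = p\<^sup>k\<close>: the descent condition at block \<open>2(k + j) - 2\<close> in terms of \<open>L = L\<^sub>j\<close>, \<open>u = u\<^sub>j\<close>,
  and at block \<open>2(k + j) - 1\<close> in terms of \<open>L = L\<^sub>j\<^sub>+\<^sub>1\<close>, \<open>u = u\<^sub>j\<^sub>+\<^sub>1\<close>, \<open>v = u\<^sub>j\<close>. Adjacent blocks have the same
  size \<open>q(p - 1)\<close>, so the two inequalities defining a descent are equivalent.
\<close>

definition even_desc :: "nat \<Rightarrow> nat \<Rightarrow> nat \<Rightarrow> nat \<Rightarrow> bool" where
  "even_desc p q L u \<longleftrightarrow> (L + q * u) - (L + q * u) div p + q * u < q * (p - 1)"

definition odd_desc :: "nat \<Rightarrow> nat \<Rightarrow> nat \<Rightarrow> nat \<Rightarrow> nat \<Rightarrow> bool" where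
  "odd_desc p q L u v \<longleftrightarrow> q * (p - 1) < (L + q * u) - (L + q * u) div p + q * v"

section \<open>Descents of a path as conditions on its choices\<close>

lemma diff_less_iff_add_less:
  fixes N U A :: nat
  assumes "N \<le> A" "U \<le> A"
  shows "U < A - N \<and> N < A - U \<longleftrightarrow> N + U < A"
  using assms by auto

lemma less_diff_iff_less_add:
  fixes N U A :: nat
  assumes "N \<le> A" "U \<le> A"
  shows "A - N < U \<and> A - U < N \<longleftrightarrow> A < N + U"
  using assms by auto

lemma is_descent_bottom:
  assumes "3 \<le> p" "l < p ^ k" "u \<in> choices p s" "1 \<le> s"
  shows "is_descent p k s (path_of p k s l u) (2 * k) \<longleftrightarrow> u 1 < (p - 1) div 2"
  using u1_path_of[OF assms] by (simp add: is_descent_def)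

lemma is_descent_even:
  assumes "3 \<le> p" "l < p ^ k" "u \<in> choices p s" "2 \<le> j" "j \<le> s"
  shows "is_descent p k s (path_of p k s l u) (2 * (k + j) - 2) \<longleftrightarrow>
    even_desc p (p ^ k) (L_num p k s l u j) (u j)"
proof -
  have S: "2 * (k + j) - 2 + 1 = 2 * (k + j) - 1" "2 * (k + j) - 2 \<noteq> 2 * k"
    "2 * k + 2 \<le> 2 * (k + j) - 2" "2 * (k + j) - 2 \<le> 2 * (k + s) - 2"
    using assms(4,5) by auto
  have "p ^ k * u j \<le> p ^ k * (p - 1)"
    using choices_le[OF assms(3), of j] assms(4,5) by simp
  note iff = diff_less_iff_add_less[OF even_block(3)[OF assms] this]
  have n: "p ^ k * (p - 1 - u j) = p ^ k * (p - 1) - p ^ k * u j"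
    by (rule diff_mult_distrib2)
  show ?thesis
    unfolding is_descent_def S(1) odd_block[OF assms] even_block(1,2)[OF assms] even_desc_def
      L'_num_def[symmetric] n
    using S(2-4) iff by blast
qed

lemma is_descent_odd:
  assumes "3 \<le> p" "l < p ^ k" "u \<in> choices p s" "2 \<le> j" "Suc j \<le> s"
  shows "is_descent p k s (path_of p k s l u) (2 * (k + j) - 1) \<longleftrightarrow>
    odd_desc p (p ^ k) (L_num p k s l u (Suc j)) (u (Suc j)) (u j)"
proof -
  have S: "2 * (k + j) - 1 + 1 = 2 * (k + Suc j) - 2" "2 * (k + j) - 1 \<noteq> 2 * k"
    "2 * k + 2 \<le> 2 * (k + j) - 1" "2 * (k + j) - 1 \<le> 2 * (k + s) - 2"
    using assms(4,5) by auto
  have j: "2 \<le> Suc j" "j \<le> s"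
    using assms(4,5) by auto
  have "p ^ k * u j \<le> p ^ k * (p - 1)"
    using choices_le[OF assms(3), of j] assms(4,5) by simp
  note iff = less_diff_iff_less_add[OF even_block(3)[OF assms(1-3) j(1) assms(5)] this]
  have n: "p ^ k * (p - 1 - u j) = p ^ k * (p - 1) - p ^ k * u j"
    by (rule diff_mult_distrib2)
  show ?thesis
    unfolding is_descent_def S(1) odd_block[OF assms(1-4) j(2)]
      even_block(1,2)[OF assms(1-3) j(1) assms(5)] odd_desc_def L'_num_def[symmetric] n
    using S(2-4) iff by blast
qed

text \<open>Sorting the admissible block indices by parity. The range ends at the even index
  \<open>2 * (k + s) - 2\<close>, so for odd blocks \<open>j\<close> stops before
  \<open>s\<close>.\<close>

lemma is_descent_cases:
  assumes "is_descent p k s P i"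
  obtains "i = 2 * k"
  | j where "j \<in> {2..s}" "i = 2 * (k + j) - 2"
  | j where "j \<in> {2..<s}" "i = 2 * (k + j) - 1"
proof (cases "i = 2 * k")
  case False
  then have i: "2 * k + 2 \<le> i" "i \<le> 2 * (k + s) - 2"
    using assms by (auto simp: is_descent_def)
  obtain n where "i = 2 * n \<or> i = 2 * n + 1"
    by (metis evenE oddE)
  then show thesis
  proof
    assume "i = 2 * n"
    moreover from this have "n + 1 - k \<in> {2..s}" "2 * n = 2 * (k + (n + 1 - k)) - 2"
      using i by auto
    ultimately show thesis
      using that(2) by blast
  next
    assume "i = 2 * n + 1"
    moreover from this have "n + 1 - k \<in> {2..<s}" "2 * n + 1 = 2 * (k + (n + 1 - k)) - 1"
      using i by auto
    ultimately show thesis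
      using that(3) by blast
  qed
qed (use that in blast)

text \<open>The block indices come from three pairwise disjoint families, separated by parity and by
  \<open>2 * k\<close>, and the last two are injective in \<open>j\<close>. Hence the cardinalities
  add up and become sums of indicators.\<close>

lemma des_path_of:
  assumes "3 \<le> p" "l < p ^ k" "u \<in> choices p s" "1 \<le> s"
  shows "des p k s (path_of p k s l u) =
    of_bool (u 1 < (p - 1) div 2)
    + (\<Sum>j=2..s. of_bool (even_desc p (p ^ k) (L_num p k s l u j) (u j)))
    + (\<Sum>j=2..<s. of_bool (odd_desc p (p ^ k) (L_num p k s l u (Suc j)) (u (Suc j)) (u j)))"
proof -
  let ?E = "{j\<in>{2..s}. even_desc p (p ^ k) (L_num p k s l u j) (u j)}"
  let ?O = "{j\<in>{2..<s}. odd_desc p (p ^ k) (L_num p k s l u (Suc j)) (u (Suc j)) (u j)}"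
  let ?A = "if u 1 < (p - 1) div 2 then {2 * k} else {}"
  let ?e = "\<lambda>j. 2 * (k + j) - 2" and ?o = "\<lambda>j. 2 * (k + j) - 1"
  have desc: "is_descent p k s (path_of p k s l u) i \<longleftrightarrow> i \<in> ?A \<union> ?e ` ?E \<union> ?o ` ?O" for i
  proof
    assume i: "is_descent p k s (path_of p k s l u) i"
    then show "i \<in> ?A \<union> ?e ` ?E \<union> ?o ` ?O"
    proof (cases rule: is_descent_cases)
      case 1
      then show ?thesis
        using i is_descent_bottom[OF assms] by simp
    next
      case (2 j)
      then have "j \<in> ?E"
        using i is_descent_even[OF assms(1-3), of j] by simp
      then show ?thesis
        using 2 by blast
    next
      case (3 j)
      then have "j \<in> ?O"
        using i is_descent_odd[OF assms(1-3), of j] by simp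
      then show ?thesis
        using 3 by blast
    qed
  next
    assume "i \<in> ?A \<union> ?e ` ?E \<union> ?o ` ?O"
    then consider "i \<in> ?A" | j where "j \<in> ?E" "i = ?e j" | j where "j \<in> ?O" "i = ?o j"
      by blast
    then show "is_descent p k s (path_of p k s l u) i"
    proof cases
      case 1
      then show ?thesis
        using is_descent_bottom[OF assms] by (simp split: if_splits)
    next
      case (2 j)
      then show ?thesis
        using is_descent_even[OF assms(1-3), of j] by simp
    next
      case (3 j)
      then show ?thesis
        using is_descent_odd[OF assms(1-3), of j] by simp
    qed
  qed
  have disj: "?A \<inter> ?e ` ?E = {}"
    by auto
  have "?o i \<notin> ?A \<union> ?e ` ?E" if "i \<in> ?O" for i
  proof
    assume "?o i \<in> ?A \<union> ?e ` ?E"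
    then have "?o i = 2 * k \<or> (\<exists>j. ?o i = ?e j)"
      by (auto split: if_splits)
    then obtain n where "?o i = 2 * n"
      by (metis diff_mult_distrib2 mult.right_neutral)
    then have "2 * n + 1 = 2 * (k + i)"
      using \<open>i \<in> ?O\<close> by auto
    then show False
      by presburger
  qed
  then have disj': "(?A \<union> ?e ` ?E) \<inter> ?o ` ?O = {}"
    unfolding disjoint_iff by (metis (no_types, lifting) imageE)
  have inj: "inj_on ?e ?E" "inj_on ?o ?O"
    by (auto intro!: inj_onI)
  have fin: "finite ?A" "finite (?e ` ?E)" "finite (?o ` ?O)"
    by auto
  have "{i. is_descent p k s (path_of p k s l u) i} = ?A \<union> ?e ` ?E \<union> ?o ` ?O"
    using desc by (intro set_eqI) (simp only: mem_Collect_eq)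
  then have "des p k s (path_of p k s l u) = card ?A + card ?E + card ?O"
    unfolding des_def using card_Un_disjoint[OF fin(1,2) disj]
      card_Un_disjoint[OF finite_UnI[OF fin(1,2)] fin(3) disj'] card_image[OF inj(1)] card_image[OF inj(2)]
    by (simp only:)
  moreover have "card ?E = (\<Sum>j=2..s. of_bool (even_desc p (p ^ k) (L_num p k s l u j) (u j)))"
    "card ?O = (\<Sum>j=2..<s. of_bool (odd_desc p (p ^ k) (L_num p k s l u (Suc j)) (u (Suc j)) (u j)))"
    by (simp_all add: Int_def)
  moreover have "card ?A = of_bool (u 1 < (p - 1) div 2)"
    by simp
  ultimately show ?thesis
    by (simp only:)
qed

section \<open>Sums over paths as iterated sums over choices\<close>

lemma fib_num_eq_sum_choices:
  assumes "3 \<le> p" "l < p ^ k"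
  shows "fib_num p k s l = (\<Sum>u\<in>choices p s. des p k s (path_of p k s l u))"
  unfolding fib_num_def paths_def using path_of_inj[OF assms] by (simp add: sum.reindex)

lemma sum_choices_1: "(\<Sum>u\<in>choices p 1. F (u 1)) = (\<Sum>x\<le>p - 2. F x)"
proof -
  have "bij_betw (\<lambda>u. u 1) (choices p 1) {..p - 2}"
    unfolding choices_def
    \<comment> \<open>Choices are \<open>undefined\<close> off the index set, so the inverse map
      must restore exactly this default away from 1.\<close>
    by (rule bij_betw_byWitness[where f' = "\<lambda>x. (\<lambda>_. undefined)(1 := x)"])
       (auto simp: fun_eq_iff PiE_def extensional_def Pi_def)
  then show ?thesis
    by (rule sum.reindex_bij_betw)
qed

text \<open>Only coordinate 1 has the shorter range; since \<open>1 \<le> s\<close>, the coordinate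
  added at \<open>Suc s\<close> runs over all \<open>p\<close> values.\<close>

lemma sum_choices_Suc:
  assumes "1 \<le> s" "1 \<le> p"
  shows "(\<Sum>u\<in>choices p (Suc s). F u) = (\<Sum>u\<in>choices p s. \<Sum>x<p. F (u(Suc s := x)))"
proof -
  define T where "T = (\<lambda>j. if j = (1::nat) then {0..p - 2} else {0..p - 1})"
  have T: "T (Suc s) = {..<p}" "choices p s' = Pi\<^sub>E {1..s'} T" for s'
    using assms by (auto simp: T_def choices_def)
  have "{1..Suc s} = insert (Suc s) {1..s}" by auto
  then have eq: "choices p (Suc s) = (\<lambda>(x, u). u(Suc s := x)) ` ({..<p} \<times> choices p s)"
    by (simp only: T PiE_insert_eq)
  have inj: "inj_on (\<lambda>(x, u). u(Suc s := x)) ({..<p} \<times> choices p s)"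
    using inj_combinator[of "Suc s" "{1..s}" T] by (simp only: T) simp
  show ?thesis
    unfolding eq sum.reindex[OF inj]
    by (subst sum.swap) (simp add: sum.cartesian_product case_prod_unfold comp_def)
qed

lemma sum_choices_2:
  assumes "1 \<le> p"
  shows "(\<Sum>u\<in>choices p 2. F (u 1) (u 2)) = (\<Sum>x\<le>p - 2. \<Sum>y<p. F x y)"
  using sum_choices_Suc[of 1 p "\<lambda>u. F (u 1) (u 2)"] sum_choices_1[of "\<lambda>x. \<Sum>y<p. F x y" p] assms
  by (simp add: numeral_2_eq_2)

lemma sum_choices_3:
  assumes "1 \<le> p"
  shows "(\<Sum>u\<in>choices p 3. F (u 1) (u 2) (u 3)) = (\<Sum>x\<le>p - 2. \<Sum>y<p. \<Sum>z<p. F x y z)"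
  using sum_choices_Suc[of 2 p "\<lambda>u. F (u 1) (u 2) (u 3)"]
    sum_choices_2[of p "\<lambda>x y. \<Sum>z<p. F x y z"] assms
  by (simp add: numeral_3_eq_3 numeral_2_eq_2)

section \<open>The function \<open>l - l div p\<close> and its values at repdigits\<close>

text \<open>For \<open>0 < p\<close>, adding \<open>d * p\<close> raises the quotient by exactly
  \<open>d\<close>, so adding \<open>d\<close> raises it by at most \<open>d\<close>.\<close>

lemma diff_div_mono:
  fixes p :: nat
  assumes "a \<le> b"
  shows "a - a div p \<le> b - b div p"
proof (cases "p = 0")
  case False
  obtain d where d: "b = a + d"
    using assms le_Suc_ex by blast
  have "(a + d) div p \<le> (a + d * p) div p"
    using False by (intro div_le_mono) simp
  also have "\<dots> = a div p + d"
    using False by simp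
  finally show ?thesis
    unfolding d by linarith
qed (use assms in simp)

text \<open>The quotient is \<open>e * a\<close> because \<open>c < p\<close>, and the first
  hypothesis says \<open>(p - 1) * a = r - 1\<close>, which leaves \<open>e * (r - 1) + c\<close>.
  It also forces \<open>1 \<le> r\<close>, so \<open>e * r - e\<close> is not truncated.\<close>

lemma diff_div_mult_add:
  fixes p a r e c :: nat
  assumes "p * a + 1 = a + r" "c < p"
  shows "p * (e * a) + c - (p * (e * a) + c) div p = e * r - e + c"
proof -
  have "(p * (e * a) + c) div p = e * a"
    using assms(2) by simp
  moreover have "p * (e * a) + e = e * a + e * r"
    by (metis assms(1) distrib_left mult.left_commute mult.right_neutral)
  moreover have "1 \<le> r"
  proof -
    have "a \<le> p * a"
      using assms(2) by simp
    then show ?thesis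
      using assms(1) by linarith
  qed
  then have "e \<le> e * r"
    by simp
  ultimately show ?thesis
    by linarith
qed

text \<open>
  In the next two lemmas \<open>p * a + 1 = a + r\<close> encodes \<open>r = p\<^sup>n\<close>, \<open>a = 1 + p + \<dots> + p\<^sup>n\<^sup>-\<^sup>1\<close>. Then
  \<open>e * (p * a + 1)\<close> has all base-\<open>p\<close> digits equal to \<open>e\<close>, and \<open>l - l div p\<close> takes the value \<open>e * r\<close>
  there and changes on both sides because its last digit is neither \<open>0\<close> nor \<open>p - 1\<close>.
\<close>

lemma less_repdigit_iff:
  fixes p a e l r :: nat
  assumes "p * a + 1 = a + r" "0 < r" "0 < e" "e < p"
  shows "l < e * (p * a + 1) \<longleftrightarrow> l - l div p < e * r"
proof
  have le: "e \<le> e * r"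
    using assms(2) by simp
  assume "l < e * (p * a + 1)"
  then have "l \<le> p * (e * a) + (e - 1)"
    using assms(3) by (simp add: algebra_simps)
  then have "l - l div p \<le> e * r - e + (e - 1)"
    using diff_div_mono[of l "p * (e * a) + (e - 1)" p] diff_div_mult_add[OF assms(1), of "e - 1" e]
      assms(4) by simp
  then show "l - l div p < e * r"
    using assms(3) le by linarith
next
  have le: "e \<le> e * r"
    using assms(2) by simp
  assume *: "l - l div p < e * r"
  show "l < e * (p * a + 1)"
  proof (rule ccontr)
    assume "\<not> l < e * (p * a + 1)"
    then have "p * (e * a) + e \<le> l"
      by (simp add: algebra_simps)
    then have "e * r - e + e \<le> l - l div p"
      using diff_div_mono[of "p * (e * a) + e" l p] diff_div_mult_add[OF assms(1), of e e] assms(4)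
      by simp
    then show False
      using * le by linarith
  qed
qed

lemma repdigit_less_iff:
  fixes p a e l r :: nat
  assumes "p * a + 1 = a + r" "0 < r" "Suc e < p"
  shows "e * (p * a + 1) < l \<longleftrightarrow> e * r < l - l div p"
proof
  have le: "e \<le> e * r"
    using assms(2) by simp
  assume "e * (p * a + 1) < l"
  then have "p * (e * a) + Suc e \<le> l"
    by (simp add: algebra_simps)
  then have "e * r - e + Suc e \<le> l - l div p"
    using diff_div_mono[of "p * (e * a) + Suc e" l p] diff_div_mult_add[OF assms(1), of "Suc e" e]
      assms(3) by simp
  then show "e * r < l - l div p"
    using le by linarith
next
  have le: "e \<le> e * r"
    using assms(2) by simp
  assume *: "e * r < l - l div p"
  show "e * (p * a + 1) < l"
  proof (rule ccontr)
    assume "\<not> e * (p * a + 1) < l"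
    then have "l \<le> p * (e * a) + e"
      by (simp add: algebra_simps)
    then have "l - l div p \<le> e * r - e + e"
      using diff_div_mono[of l "p * (e * a) + e" p] diff_div_mult_add[OF assms(1), of e e] assms(3)
      by simp
    then show False
      using * le by linarith
  qed
qed

text \<open>By monotonicity the extreme case is \<open>l = r * p - 1\<close>, whose quotient is
  \<open>r - 1\<close>.\<close>

lemma diff_div_le:
  fixes l r p :: nat
  assumes "l < r * p"
  shows "l - l div p \<le> r * (p - 1)"
proof -
  obtain s q where s: "r = Suc s" "p = Suc q"
    using assms by (cases r; cases p) auto
  have eq: "r * p - 1 = p * s + q" "r * (p - 1) = s * q + q" "p * s = s + s * q"
    by (simp_all add: s algebra_simps)
  moreover have "q < p"
    using s(2) by simp
  then have "(p * s + q) div p = s"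
    by simp
  ultimately have "r * p - 1 - (r * p - 1) div p = r * (p - 1)"
    by simp
  then show ?thesis
    using diff_div_mono[of l "r * p - 1" p] assms by simp
qed

text \<open>The summand \<open>r * p * u\<close> is a multiple of \<open>p\<close>, so the floor
  splits exactly. With \<open>p ^ k = r * p\<close> this separates the contribution of a choice
  \<open>u\<close> from that of \<open>l\<close>.\<close>

lemma diff_div_add_mult:
  fixes l r p u :: nat
  assumes "0 < p"
  shows "(l + r * p * u) - (l + r * p * u) div p = (l - l div p) + r * (p - 1) * u"
proof -
  have "r * p * u = r * u * p"
    by simp
  then have "(l + r * p * u) div p = l div p + r * u"
    using assms by (simp only: div_mult_self1)
  moreover have "l div p \<le> l"
    by simp
  moreover have "r * p * u = r * (p - 1) * u + r * u"
    using assms by (cases p) (auto simp: algebra_simps)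
  ultimately show ?thesis
    by linarith
qed

section \<open>Descent conditions as comparisons of choices\<close>

text \<open>With \<open>F = l - l div p\<close> the condition reads
  \<open>F + (4 * h + 1) * r * u < 2 * h * (2 * h + 1) * r\<close>. At \<open>u = h\<close> this is
  \<open>F < h * r\<close>; any other \<open>u\<close> shifts the left side by at least
  \<open>(4 * h + 1) * r\<close>, which outweighs the whole range of \<open>F\<close>, from 0 to
  \<open>2 * h * r\<close>.\<close>

lemma even_desc_iff:
  assumes "p = 2 * h + 1" "l < r * p"
  shows "even_desc p (r * p) l u \<longleftrightarrow> u < h \<or> u = h \<and> l - l div p < h * r"
proof -
  define F where "F = l - l div p"
  have F: "F \<le> r * (2 * h)" "0 < r"
    using diff_div_le[OF assms(2)] assms by (auto simp: F_def intro: gr0I)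
  have "even_desc p (r * p) l u \<longleftrightarrow> F + r * (2 * h) * u + r * (2 * h + 1) * u < r * (2 * h + 1) * (2 * h)"
    unfolding even_desc_def using diff_div_add_mult[of p l r u] assms(1) by (simp add: F_def)
  also have "\<dots> \<longleftrightarrow> u < h \<or> u = h \<and> F < h * r"
  proof -
    consider d where "h = u + 1 + d" | "u = h" | d where "u = h + 1 + d"
      using less_imp_Suc_add[of u h] less_imp_Suc_add[of h u] by fastforce
    then show ?thesis
    proof cases
      case 1
      then show ?thesis
        using F by (simp add: algebra_simps)
    next
      case 2
      then show ?thesis
        by (simp add: algebra_simps)
    next
      case 3
      then show ?thesis
        by (simp add: algebra_simps)
    qed
  qed
  finally show ?thesis
    by (simp add: F_def)
qed

text \<open>Replacing the lower choice by its complement \<open>e\<close> turns the condition into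
  \<open>(2 * h + 1) * r * e < F + 2 * h * r * v\<close>. At \<open>e = v\<close> this is
  \<open>e * r < F\<close>; otherwise the order of \<open>e\<close> and \<open>v\<close> decides,
  because \<open>F \<le> 2 * h * r\<close> and \<open>e \<le> 2 * h\<close>.\<close>

lemma odd_desc_iff:
  assumes "p = 2 * h + 1" "l < r * p" "v < p" "e < p"
  shows "odd_desc p (r * p) l v (p - Suc e) \<longleftrightarrow> e < v \<or> e = v \<and> e * r < l - l div p"
proof -
  define F where "F = l - l div p"
  have F: "F \<le> r * (2 * h)" "0 < r"
    using diff_div_le[OF assms(2)] assms by (auto simp: F_def intro: gr0I)
  obtain w where w: "p - Suc e = w" "2 * h = e + w"
    using assms by (intro that[of "2 * h - e"]) auto
  have "odd_desc p (r * p) l v w \<longleftrightarrow> r * (2 * h + 1) * (2 * h) < F + r * (2 * h) * v + r * (2 * h + 1) * w"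
    unfolding odd_desc_def using diff_div_add_mult[of p l r v] assms(1) by (simp add: F_def)
  also have "\<dots> \<longleftrightarrow> r * (2 * h + 1) * e < F + r * (2 * h) * v"
    using w(2) by (metis add_less_cancel_right distrib_left)
  also have "\<dots> \<longleftrightarrow> e < v \<or> e = v \<and> e * r < F"
  proof -
    consider d where "v = e + 1 + d" | "e = v" | d where "e = v + 1 + d"
      using less_imp_Suc_add[of e v] less_imp_Suc_add[of v e] by fastforce
    then show ?thesis
    proof cases
      case 1
      have "r * e < r * (2 * h)"
        using 1 assms F(2) by simp
      moreover have "r * (2 * h + 1) * e = r * (2 * h) * e + r * e"
        "r * (2 * h) * v = r * (2 * h) * e + r * (2 * h) + r * (2 * h) * d"
        using 1 by (simp_all add: algebra_simps)
      ultimately have "r * (2 * h + 1) * e < F + r * (2 * h) * v"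
        by linarith
      then show ?thesis
        using 1 by simp
    next
      case 2
      then show ?thesis
        by (simp add: algebra_simps)
    next
      case 3
      then show ?thesis
        using F by (simp add: algebra_simps)
    qed
  qed
  finally show ?thesis
    by (simp add: F_def w)
qed

lemma des_path_of_2:
  assumes "3 \<le> p" "l < p ^ k" "u \<in> choices p 2"
  shows "des p k 2 (path_of p k 2 l u) =
    of_bool (u 1 < (p - 1) div 2) + of_bool (even_desc p (p ^ k) l (u 2))"
  using des_path_of[OF assms] by (simp add: L_num_def)

lemma des_path_of_3:
  assumes "3 \<le> p" "l < p ^ k" "u \<in> choices p 3"
  shows "des p k 3 (path_of p k 3 l u) =
    of_bool (u 1 < (p - 1) div 2)
    + of_bool (even_desc p (p ^ k) ((l + p ^ k * u 3) div p) (u 2))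
    + of_bool (even_desc p (p ^ k) l (u 3))
    + of_bool (odd_desc p (p ^ k) l (u 3) (u 2))"
proof -
  have "{2..3} = {2, 3::nat}" "{2..<3} = {2::nat}"
    by auto
  moreover have "L_num p k 3 l u 3 = l" "L_num p k 3 l u 2 = (l + p ^ k * u 3) div p"
    by (simp_all add: L_num_def numeral_3_eq_3 numeral_2_eq_2)
  moreover have "Suc 2 = 3"
    by simp
  ultimately show ?thesis
    using des_path_of[OF assms] by (simp del: sum_of_bool_eq)
qed

section \<open>Counting the choices that give a descent\<close>

lemma sum_of_bool_less:
  "(\<Sum>x<n. of_bool (x < m)) = min m n"
  for n m :: nat
proof -
  have "{..<n} \<inter> {x. x < m} = {..<min m n}"
    by auto
  then show ?thesis
    by simp
qed

lemma sum_bottom: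
  assumes "p = 2 * h + 1" "0 < h"
  shows "(\<Sum>x\<le>p - 2. of_bool (x < (p - 1) div 2)) = h" "card {..p - 2} = 2 * h"
proof -
  have "{..p - 2} = {..<2 * h}" "(p - 1) div 2 = h"
    using assms by auto
  then show "(\<Sum>x\<le>p - 2. of_bool (x < (p - 1) div 2)) = h" "card {..p - 2} = 2 * h"
    by (simp_all only: sum_of_bool_less card_lessThan)
qed

lemma sum_even_desc:
  assumes "p = 2 * h + 1" "l < r * p"
  shows "(\<Sum>u<p. of_bool (even_desc p (r * p) l u)) = h + of_bool (l - l div p < h * r)"
proof -
  have "(\<Sum>u<p. of_bool (even_desc p (r * p) l u)) =
      (\<Sum>u<p. of_bool (u < h) + of_bool (l - l div p < h * r) * of_bool (u = h) :: nat)"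
    by (intro sum.cong) (auto simp: even_desc_iff[OF assms])
  also have "\<dots> = (\<Sum>u<p. of_bool (u < h)) + of_bool (l - l div p < h * r) * (\<Sum>u<p. of_bool (u = h))"
    by (simp only: sum.distrib sum_distrib_left)
  also have "(\<Sum>u<p. of_bool (u = h)) = (1::nat)"
    using assms by (simp add: of_bool_def)
  also have "(\<Sum>u<p. of_bool (u < h)) = h"
    using assms(1) by (subst sum_of_bool_less) simp
  finally show ?thesis
    by simp
qed

text \<open>For fixed \<open>v\<close> there are \<open>v\<close> strict cases \<open>e < v\<close>
  and a possible tie \<open>e = v\<close>. The strict cases total
  \<open>0 + ... + 2 * h = h * p\<close>.\<close>

lemma sum_odd_desc:
  assumes "p = 2 * h + 1" "l < r * p"
  shows "(\<Sum>v<p. \<Sum>w<p. of_bool (odd_desc p (r * p) l v w)) =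
    h * p + (\<Sum>e<p. of_bool (e * r < l - l div p))"
proof -
  have "(\<Sum>w<p. of_bool (odd_desc p (r * p) l v w)) = v + of_bool (v * r < l - l div p)"
    if "v < p" for v
  proof -
    have "(\<Sum>w<p. of_bool (odd_desc p (r * p) l v w)) =
        (\<Sum>e<p. of_bool (odd_desc p (r * p) l v (p - Suc e)) :: nat)"
      by (rule sum.nat_diff_reindex[symmetric])
    also have "\<dots> = (\<Sum>e<p. of_bool (e < v) + of_bool (v * r < l - l div p) * of_bool (e = v))"
      using odd_desc_iff[OF assms that] by (intro sum.cong) auto
    also have "\<dots> = (\<Sum>e<p. of_bool (e < v)) + of_bool (v * r < l - l div p) * (\<Sum>e<p. of_bool (e = v))"
      by (simp only: sum.distrib sum_distrib_left)
    also have "(\<Sum>e<p. of_bool (e = v)) = (1::nat)"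
      using that by (simp add: of_bool_def)
    also have "(\<Sum>e<p. of_bool (e < v)) = v"
      using that by (subst sum_of_bool_less) simp
    finally show ?thesis
      by simp
  qed
  then have "(\<Sum>v<p. \<Sum>w<p. of_bool (odd_desc p (r * p) l v w)) =
      (\<Sum>v<p. v + of_bool (v * r < l - l div p))"
    by (intro sum.cong) auto
  also have "(\<Sum>v<p. v) = h * p"
    unfolding assms(1) by (induction h) auto
  then have "(\<Sum>v<p. v + of_bool (v * r < l - l div p)) = h * p + (\<Sum>e<p. of_bool (e * r < l - l div p))"
    by (simp only: sum.distrib)
  finally show ?thesis .
qed

section \<open>The numbers for one, two and three levels\<close>

lemma fib_num_1:
  assumes "p = 2 * h + 1" "0 < h" "l < p ^ k"
  shows "fib_num p k 1 l = h"
proof -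
  have p: "3 \<le> p" using assms by simp
  have "fib_num p k 1 l = (\<Sum>u\<in>choices p 1. of_bool (u 1 < (p - 1) div 2))"
    unfolding fib_num_eq_sum_choices[OF p assms(3)]
    using des_path_of[OF p assms(3)] by (intro sum.cong) auto
  also have "\<dots> = h"
    unfolding sum_choices_1[of "\<lambda>x. of_bool (x < (p - 1) div 2)"] by (rule sum_bottom(1)[OF assms(1,2)])
  finally show ?thesis .
qed

text \<open>Each condition is counted once per value of the choice it does not involve:
  \<open>p\<close> times for \<open>u 1\<close>, and \<open>2 * h\<close> times for
  \<open>u 2\<close>.\<close>

lemma fib_num_2:
  assumes "p = 2 * h + 1" "0 < h" "p ^ k = r * p" "l < p ^ k"
  shows "fib_num p k 2 l = h * (p + 2 * (h + of_bool (l - l div p < h * r)))"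
proof -
  have p: "3 \<le> p" using assms by simp
  let ?e = "\<lambda>y. of_bool (even_desc p (p ^ k) l y) :: nat" and ?b = "\<lambda>x. of_bool (x < (p - 1) div 2) :: nat"
  have "fib_num p k 2 l = (\<Sum>u\<in>choices p 2. ?b (u 1) + ?e (u 2))"
    unfolding fib_num_eq_sum_choices[OF p assms(4)]
    using des_path_of_2[OF p assms(4)] by (intro sum.cong) auto
  also have "\<dots> = (\<Sum>x\<le>p - 2. \<Sum>y<p. ?b x + ?e y)"
    using p by (intro sum_choices_2[of p "\<lambda>x y. ?b x + ?e y"]) simp
  also have "\<dots> = p * (\<Sum>x\<le>p - 2. ?b x) + card {..p - 2} * (\<Sum>y<p. ?e y)"
    by (simp only: sum.distrib sum_constant sum_distrib_left card_lessThan of_nat_id)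
  also have "\<dots> = h * (p + 2 * (\<Sum>y<p. ?e y))"
    unfolding sum_bottom[OF assms(1,2)] by (simp only: algebra_simps)
  also have "(\<Sum>y<p. ?e y) = h + of_bool (l - l div p < h * r)"
    using assms by (simp only: sum_even_desc)
  finally show ?thesis .
qed

text \<open>The lower even block depends on \<open>u 3\<close> as well as \<open>u 2\<close>,
  through \<open>l div p + r * u 3\<close>, and the odd block couples the same two choices. Both are
  therefore counted over pairs.\<close>

lemma fib_num_3:
  assumes "p = 2 * h + 1" "0 < h" "p ^ k = r * p" "l < p ^ k"
  shows "fib_num p k 3 l = h * (p ^ 2 + 2 *
    ((\<Sum>z<p. h + of_bool ((l div p + r * z) - (l div p + r * z) div p < h * r))
     + p * (h + of_bool (l - l div p < h * r))
     + (h * p + (\<Sum>e<p. of_bool (e * r < l - l div p)))))"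
proof -
  have p: "3 \<le> p" using assms by simp
  let ?b = "\<lambda>x. of_bool (x < (p - 1) div 2) :: nat"
  let ?e = "\<lambda>l y. of_bool (even_desc p (p ^ k) l y) :: nat"
  let ?o = "\<lambda>z y. of_bool (odd_desc p (p ^ k) l z y) :: nat"
  have L: "(l + p ^ k * z) div p = l div p + r * z" for z
  proof -
    have "p ^ k * z = r * z * p"
      using assms(3) by simp
    then show ?thesis
      using p by (simp only: div_mult_self1)
  qed
  \<comment> \<open>The lower even block sees this number in place of \<open>l\<close>; it must
    again be below \<open>p ^ k\<close> for \<open>sum_even_desc\<close> to apply.\<close>
  have less: "l div p + r * z < r * p" if "z < p" for z
  proof -
    have "l div p < r"
      using assms(3,4) by (simp add: less_mult_imp_div_less)
    moreover have "r * Suc z \<le> r * p"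
      using that by (intro mult_le_mono2) simp
    ultimately show ?thesis
      by simp
  qed
  have "fib_num p k 3 l = (\<Sum>u\<in>choices p 3. ?b (u 1) + ?e (l div p + r * u 3) (u 2) + ?e l (u 3) + ?o (u 3) (u 2))"
    unfolding fib_num_eq_sum_choices[OF p assms(4)]
    using des_path_of_3[OF p assms(4)] unfolding L by (intro sum.cong) auto
  also have "\<dots> = (\<Sum>x\<le>p - 2. \<Sum>y<p. \<Sum>z<p. ?b x + ?e (l div p + r * z) y + ?e l z + ?o z y)"
    using p by (intro sum_choices_3[of p "\<lambda>x y z. ?b x + ?e (l div p + r * z) y + ?e l z + ?o z y"]) simp
  also have "\<dots> = p * (p * (\<Sum>x\<le>p - 2. ?b x)) + card {..p - 2} * ((\<Sum>y<p. \<Sum>z<p. ?e (l div p + r * z) y)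
      + p * (\<Sum>z<p. ?e l z) + (\<Sum>y<p. \<Sum>z<p. ?o z y))"
    by (simp only: sum.distrib sum_constant sum_distrib_left card_lessThan of_nat_id distrib_left)
  also have "\<dots> = h * (p ^ 2 + 2 * ((\<Sum>y<p. \<Sum>z<p. ?e (l div p + r * z) y)
      + p * (\<Sum>z<p. ?e l z) + (\<Sum>y<p. \<Sum>z<p. ?o z y)))"
    unfolding sum_bottom[OF assms(1,2)] by (simp only: algebra_simps power2_eq_square)
  also have "(\<Sum>y<p. \<Sum>z<p. ?e (l div p + r * z) y) =
      (\<Sum>z<p. h + of_bool ((l div p + r * z) - (l div p + r * z) div p < h * r))"
    unfolding assms(3) using sum_even_desc[OF assms(1) less]
    by (subst sum.swap) (auto intro!: sum.cong)
  also have "(\<Sum>z<p. ?e l z) = h + of_bool (l - l div p < h * r)"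
    using assms by (simp only: sum_even_desc)
  also have "(\<Sum>y<p. \<Sum>z<p. ?o z y) = h * p + (\<Sum>e<p. of_bool (e * r < l - l div p))"
    using assms by (subst sum.swap) (simp only: sum_odd_desc)
  finally show ?thesis .
qed

lemma fib_num_2_repdigit:
  assumes "p = 2 * h + 1" "0 < h" "p ^ k = r * p" "l < p ^ k" "p * a + 1 = a + r" "0 < r"
  shows "fib_num p k 2 l = h * (p + 2 * (h + of_bool (l < h * (p * a + 1))))"
  using fib_num_2[OF assms(1-4)] less_repdigit_iff[OF assms(5,6,2)] assms(1) by simp

text \<open>Turns every comparison in \<open>fib_num_3\<close> into a threshold on \<open>l\<close>
  itself.\<close>

lemma fib_num_3_repdigit:
  assumes "p = 2 * h + 1" "0 < h" "p ^ k = r * p" "l < p ^ k" "p * a + 1 = a + r" "0 < r"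
  shows "fib_num p k 3 l = h * (p ^ 2 + 2 *
    ((p * h + h + of_bool (l < p * (h * a)))
     + p * (h + of_bool (l < h * (p * a + 1)))
     + (h * p + (\<Sum>e<p. of_bool (e * (p * a + 1) < l)))))"
proof -
  have p: "3 \<le> p" using assms by simp
  have r: "r = 2 * h * a + 1"
    using assms(1,5) by simp
  have rp: "r * p = 2 * h * (p * a + 1) + 1"
    unfolding r assms(1) by (simp add: algebra_simps)
  define q where "q = l div p"
  have q: "q < r"
    using assms(3,4) by (simp add: q_def less_mult_imp_div_less)
  have "(q + r * z) - (q + r * z) div p < h * r \<longleftrightarrow> z < h \<or> z = h \<and> l < p * (h * a)" for z
  proof -
    have "(q + r * z) - (q + r * z) div p < h * r \<longleftrightarrow> q + r * z < h * (p * a + 1)"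
      using less_repdigit_iff[OF assms(5,6,2)] assms(1) by simp
    also have "h * (p * a + 1) = r * h + h * a"
      using assms(5) by (simp add: algebra_simps)
    \<comment> \<open>The threshold has quotient \<open>h\<close> and remainder
      \<open>h * a < r\<close> on division by \<open>r\<close>, and \<open>q < r\<close>, so the
      comparison is lexicographic in \<open>(z, q)\<close>.\<close>
    also have "q + r * z < r * h + h * a \<longleftrightarrow> z < h \<or> z = h \<and> q < h * a"
    proof -
      consider d where "h = z + 1 + d" | "z = h" | d where "z = h + 1 + d"
        using less_imp_Suc_add[of z h] less_imp_Suc_add[of h z] by fastforce
      then show ?thesis
      proof cases
        case (1 d)
        then have "r * h = r * z + r + r * d"
          by (simp add: algebra_simps)
        then show ?thesis
          using 1 q by simp
      next
        case (3 d)
        then have "r * z = r * h + r + r * d"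
          by (simp add: algebra_simps)
        moreover have "h * a < r"
          unfolding r by simp
        ultimately show ?thesis
          using 3 by simp
      qed simp
    qed
    also have "q < h * a \<longleftrightarrow> l < p * (h * a)"
      unfolding q_def using p by (simp add: div_less_iff_less_mult mult.commute)
    finally show ?thesis .
  qed
  then have "(\<Sum>z<p. h + of_bool ((q + r * z) - (q + r * z) div p < h * r)) =
      (\<Sum>z<p. h + (of_bool (z < h) + of_bool (l < p * (h * a)) * of_bool (z = h)))"
    by (intro sum.cong) auto
  also have "\<dots> = p * h + ((\<Sum>z<p. of_bool (z < h)) + of_bool (l < p * (h * a)) * (\<Sum>z<p. of_bool (z = h)))"
    by (simp only: sum.distrib sum_distrib_left sum_constant card_lessThan of_nat_id)
  also have "(\<Sum>z<p. of_bool (z = h)) = (1::nat)"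
    using assms by (simp add: of_bool_def)
  also have "(\<Sum>z<p. of_bool (z < h)) = h"
    using assms(1) by (subst sum_of_bool_less) simp
  finally have 1: "(\<Sum>z<p. h + of_bool ((q + r * z) - (q + r * z) div p < h * r)) =
      p * h + h + of_bool (l < p * (h * a))"
    by simp
  have 2: "(\<Sum>e<p. of_bool (e * r < l - l div p)) = (\<Sum>e<p. of_bool (e * (p * a + 1) < l) :: nat)"
  proof (intro sum.cong arg_cong[where f = of_bool] refl)
    fix e assume "e \<in> {..<p}"
    then consider "Suc e < p" | "e = 2 * h"
      using assms(1) by fastforce
    then show "e * r < l - l div p \<longleftrightarrow> e * (p * a + 1) < l"
    proof cases
      case 1
      then show ?thesis
        using repdigit_less_iff[OF assms(5,6)] by simp
    next
      \<comment> \<open>The digit \<open>p - 1\<close> is outside \<open>repdigit_less_iff\<close>.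
        Here both sides are false, since \<open>l < r * p = 2 * h * (p * a + 1) + 1\<close>.\<close>
      case 2
      have "l - l div p \<le> e * r"
        using diff_div_le[of l r p] assms 2 by (simp add: mult.commute)
      moreover have "l \<le> e * (p * a + 1)"
        using assms(3,4) rp 2 by simp
      ultimately show ?thesis
        by simp
    qed
  qed
  have 3: "l - l div p < h * r \<longleftrightarrow> l < h * (p * a + 1)"
    using less_repdigit_iff[OF assms(5,6,2)] assms(1) by simp
  show ?thesis
    unfolding fib_num_3[OF assms(1-4)] 2 3 unfolding q_def[symmetric] 1 ..
qed

text \<open>The bounds place \<open>l\<close> between consecutive multiples of \<open>S\<close>.
  They exclude \<open>l = 0\<close>, where the count is 0 and the theorem argues directly.\<close>

lemma sum_of_bool_repdigit:
  fixes S t l p :: nat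
  assumes "(t - 1) * S < l" "l \<le> t * S" "t \<le> p"
  shows "(\<Sum>e<p. of_bool (e * S < l)) = t"
proof -
  have "e * S < l \<longleftrightarrow> e < t" for e
  proof
    assume "e * S < l"
    then show "e < t"
      using assms(2) by (meson le_less_trans less_le_trans linorder_not_le mult_le_mono1 order.asym)
  next
    assume "e < t"
    then have "e * S \<le> (t - 1) * S"
      by (intro mult_le_mono1) simp
    then show "e * S < l"
      using assms(1) by (rule le_less_trans)
  qed
  then show ?thesis
    using assms(3) by (simp only: sum_of_bool_less)
qed

theorem theorem25:
  fixes p k l :: nat
  assumes "prime p" and "odd p" and "k \<ge> 2" and "l < p ^ k"
  shows "int (fib_num p k 1 l) = (int p - 1) div 2
    \<and> (l < (p ^ k - 1) div 2 \<longrightarrow>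
         int (fib_num p k 2 l) = (int p - 1) div 2 * (2 * int p + 1))
    \<and> ((p ^ k - 1) div 2 \<le> l \<longrightarrow>
         int (fib_num p k 2 l) = (int p - 1) div 2 * (2 * int p - 1))
    \<and> (l = 0 \<longrightarrow>
         int (fib_num p k 3 l) = (int p - 1) div 2 * (4 * int p ^ 2 + 1))
    \<and> (\<forall>t. 1 \<le> t \<and> t \<le> (p - 3) div 2 \<and>
            (t - 1) * (\<Sum>i=0..k-1. p ^ i) + 1 \<le> l \<and> l \<le> t * (\<Sum>i=0..k-1. p ^ i) \<longrightarrow>
         int (fib_num p k 3 l) = (int p - 1) div 2 * (4 * int p ^ 2 + 2 * int t + 1))
    \<and> ((p - 3) div 2 * (\<Sum>i=0..k-1. p ^ i) + 1 \<le> l \<and>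
         l \<le> (p - 1) div 2 * (\<Sum>i=1..k-1. p ^ i) - 1 \<longrightarrow>
         int (fib_num p k 3 l) = (int p - 1) div 2 * (4 * int p ^ 2 + 1 + int p - 1))
    \<and> ((p - 1) div 2 * (\<Sum>i=1..k-1. p ^ i) \<le> l \<and>
         l \<le> (p - 1) div 2 * (\<Sum>i=0..k-1. p ^ i) - 1 \<longrightarrow>
         int (fib_num p k 3 l) = (int p - 1) div 2 * (4 * int p ^ 2 - 1 + int p - 1))
    \<and> (l = (p - 1) div 2 * (\<Sum>i=0..k-1. p ^ i) \<longrightarrow>
         int (fib_num p k 3 l) = (int p - 1) div 2 * (4 * int p ^ 2 - 1 - int p - 1))
    \<and> (\<forall>t. (p + 1) div 2 \<le> t \<and> t \<le> p - 1 \<and>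
            (t - 1) * (\<Sum>i=0..k-1. p ^ i) + 1 \<le> l \<and> l \<le> t * (\<Sum>i=0..k-1. p ^ i) \<longrightarrow>
         int (fib_num p k 3 l) =
           (int p - 1) div 2 * (4 * int p ^ 2 - 1 + 2 * (int t - int p)))"
proof -
  obtain h where ph: "p = 2 * h + 1"
    using assms(2) by (elim oddE)
  have h: "0 < h"
    using assms(1) ph by (auto intro: gr0I)
  obtain n where n: "k = Suc (Suc n)"
    using assms(3) by (auto dest!: le_Suc_ex)
  \<comment> \<open>With \<open>n = k - 2\<close>, \<open>a\<close> and \<open>S\<close> are the
    base-\<open>p\<close> repunits with \<open>k - 1\<close> and \<open>k\<close> digits, and
    \<open>r = p ^ (k - 1)\<close>.\<close>
  define a S r where "a = (\<Sum>i\<le>n. p ^ i)" and "S = p * a + 1" and "r = p ^ Suc n"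
  have a: "0 < a"
    unfolding a_def using ph by (intro sum_pos) auto
  have r: "0 < r" "p ^ k = r * p" "p * a + 1 = a + r"
  proof -
    show "0 < r" "p ^ k = r * p"
      by (simp_all add: r_def n ph)
    show "p * a + 1 = a + r"
      unfolding a_def r_def by (induction n) (simp_all add: algebra_simps)
  qed
  have S1: "(\<Sum>i=1..k-1. p ^ i) = p * a"
  proof -
    have "(\<Sum>i=Suc 0..Suc n. p ^ i) = (\<Sum>i=0..n. p ^ Suc i)"
      by (rule sum.shift_bounds_cl_Suc_ivl)
    then show ?thesis
      by (simp add: n a_def sum_distrib_left atLeast0AtMost)
  qed
  have S0: "(\<Sum>i=0..k-1. p ^ i) = S"
  proof -
    have "(\<Sum>i=0..k-1. p ^ i) = p ^ 0 + (\<Sum>i=Suc 0..k-1. p ^ i)"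
      by (rule sum.atLeast_Suc_atMost) simp
    then show ?thesis
      using S1 by (simp add: S_def)
  qed
  have half: "(p ^ k - 1) div 2 = h * S"
  proof -
    have "r = 2 * h * a + 1"
      using r(3) ph by simp
    then have "r * p = 2 * (h * S) + 1"
      unfolding S_def ph by (simp add: algebra_simps)
    then show ?thesis
      using r(2) by simp
  qed
  have hS: "h * S = p * (h * a) + h" "(h - 1) * S + S = h * S"
    using h by (auto simp: S_def algebra_simps gr0_conv_Suc)
  \<comment> \<open>The resulting bound \<open>h < S\<close> gives
    \<open>(h - 1) * S < p * (h * a)\<close>, so the extra threshold \<open>p * (h * a)\<close> lies
    strictly between two consecutive multiples of \<open>S\<close>.\<close>
  have "h * 1 \<le> p * a"
    using a ph by (intro mult_le_mono) auto
  then have less_S: "h < S"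
    by (simp add: S_def)
  have h_simps: "(int p - 1) div 2 = int h" "(p - 1) div 2 = h" "(p - 3) div 2 = h - 1" "(p + 1) div 2 = h + 1"
    using ph by auto
  have fib2: "int (fib_num p k 2 l) = int h * (2 * int p - 1 + 2 * of_bool (l < h * S))"
    unfolding fib_num_2_repdigit[OF ph h r(2) assms(4) r(3,1)] S_def[symmetric]
    by (simp add: ph of_nat_of_bool algebra_simps)
  \<comment> \<open>Uses \<open>2 * h = p - 1\<close> to rewrite
    \<open>p ^ 2 + 6 * p * h + 2 * h\<close>. Each case for three levels then amounts to deciding
    two indicators and the count \<open>t\<close>.\<close>
  have fib3: "int (fib_num p k 3 l) = int h * (4 * int p ^ 2 - 2 * int p - 1
      + 2 * int p * of_bool (l < h * S) + 2 * of_bool (l < p * (h * a)) + 2 * int t)"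
    if "(\<Sum>e<p. of_bool (e * S < l)) = t" for t
    unfolding fib_num_3_repdigit[OF ph h r(2) assms(4) r(3,1)] S_def[symmetric] that
    by (simp add: ph of_nat_of_bool power2_eq_square algebra_simps)
  have pha: "h * (p * a) = p * (h * a)"
    by simp
  have "int (fib_num p k 1 l) = int h"
    using fib_num_1[OF ph h assms(4)] by simp
  moreover have "int (fib_num p k 2 l) = int h * (2 * int p + 1)" if "l < h * S"
    using fib2 that by simp
  moreover have "int (fib_num p k 2 l) = int h * (2 * int p - 1)" if "h * S \<le> l"
    using fib2 that by simp
  moreover have "int (fib_num p k 3 l) = int h * (4 * int p ^ 2 + 1)" if "l = 0"
    using fib3[of 0] that h a less_S ph by (simp add: algebra_simps)
  moreover have "int (fib_num p k 3 l) = int h * (4 * int p ^ 2 + 2 * int t + 1)"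
    if t: "1 \<le> t" "t \<le> h - 1" "(t - 1) * S + 1 \<le> l" "l \<le> t * S" for t
  proof -
    have "t * S \<le> (h - 1) * S"
      using t(2) by (rule mult_le_mono1)
    then have "l < p * (h * a)" "l < h * S"
      using t(4) less_S hS by linarith+
    moreover have "(\<Sum>e<p. of_bool (e * S < l)) = t"
      using t ph by (intro sum_of_bool_repdigit) auto
    ultimately show ?thesis
      using fib3[of t] by simp
  qed
  moreover have "int (fib_num p k 3 l) = int h * (4 * int p ^ 2 + 1 + int p - 1)"
    if l: "(h - 1) * S + 1 \<le> l" "l \<le> h * (p * a) - 1"
  proof -
    \<comment> \<open>Positivity makes the truncated \<open>- 1\<close> in the upper bound a true
      one, so the bound is strict.\<close>
    have "0 < p * (h * a)"
      using h a ph by simp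
    then have "l < p * (h * a)" "l < h * S"
      using l(2) hS(1) unfolding pha by linarith+
    moreover from this have "(\<Sum>e<p. of_bool (e * S < l)) = h"
      using l(1) ph by (intro sum_of_bool_repdigit) auto
    ultimately show ?thesis
      using fib3[of h] ph by simp
  qed
  moreover have "int (fib_num p k 3 l) = int h * (4 * int p ^ 2 - 1 + int p - 1)"
    if l: "h * (p * a) \<le> l" "l \<le> h * S - 1"
  proof -
    have "\<not> l < p * (h * a)" "l < h * S" "(h - 1) * S < l"
      using l h less_S hS unfolding pha by linarith+
    moreover from this have "(\<Sum>e<p. of_bool (e * S < l)) = h"
      using ph by (intro sum_of_bool_repdigit) auto
    ultimately show ?thesis
      using fib3[of h] ph by simp
  qed
  moreover have "int (fib_num p k 3 l) = int h * (4 * int p ^ 2 - 1 - int p - 1)"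
    if l: "l = h * S"
  proof -
    have "\<not> l < p * (h * a)" "\<not> l < h * S" "(h - 1) * S < l"
      using l less_S hS by linarith+
    moreover from this have "(\<Sum>e<p. of_bool (e * S < l)) = h"
      using l ph by (intro sum_of_bool_repdigit) auto
    ultimately show ?thesis
      using fib3[of h] ph by simp
  qed
  moreover have "int (fib_num p k 3 l) = int h * (4 * int p ^ 2 - 1 + 2 * (int t - int p))"
    if t: "h + 1 \<le> t" "t \<le> p - 1" "(t - 1) * S + 1 \<le> l" "l \<le> t * S" for t
  proof -
    have "h * S \<le> (t - 1) * S"
      using t(1) by (intro mult_le_mono1) simp
    then have "\<not> l < p * (h * a)" "\<not> l < h * S"
      using t(3) hS by linarith+
    moreover have "(\<Sum>e<p. of_bool (e * S < l)) = t"
      using t by (intro sum_of_bool_repdigit) auto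
    ultimately show ?thesis
      using fib3[of t] by simp
  qed
  ultimately show ?thesis
    unfolding S0 S1 half h_simps by blast
qed

end
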